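(* Let $\mathfrak{g}=\mathfrak{g}_L\ltimes\mathfrak{h}$ be a non-semisimple Lie algebra with simple Levi subalgebra $\mathfrak{g}_L$ and $\mathfrak{h}=\mathrm{Rad}(\mathfrak{g})$. Let $\mathfrak{h}=V_{n_1}\oplus\cdots\oplus V_{n_k}$ be a decomposition into simple $\mathfrak{g}_L$-modules such that whenever $[V_{n_i},V_{n_j}]\neq 0$ there is a unique $p\in\{1,\dots,k\}$ with $[V_{n_i},V_{n_j}]=V_{n_p}$. If $\mathfrak{g}$ is sympathetic, then $s(\mathfrak{g})\geq 4$, where $s(\mathfrak{g}):=k$.
   Context: All Lie algebras and vector spaces are finite dimensional over $\mathbb{C}$. A Lie algebra $\mathfrak{g}$ is sympathetic if $Z(\mathfrak{g})=0$, $\mathfrak{g}=[\mathfrak{g},\mathfrak{g}]$ and $\mathrm{Der}(\mathfrak{g})=\mathrm{ad}(\mathfrak{g})$. $\mathfrak{g}=\mathfrak{g}_L\ltimes\mathfrak{h}$ is a Levi decomposition, and $\mathfrak{h}$ is a $\mathfrak{g}_L$-module via the Lie bracket; $s(\mathfrak{g})$ is the number of simple $\mathfrak{g}_L$-modules in a decomposition of $\mathfrak{h}$. Distinct summands may be isomorphic. $[A,B]$ denotes the linear span of all brackets $[a,b]$, $a\in A$, $b\in B$. *)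

theory Defs
  imports Complex_Main
begin

text \<open>
  A Lie algebra is the full vector space carried by the type; its subalgebras, ideals and
  submodules are subsets. Properties that are also needed for a subalgebra
  (solvability, radical, semisimplicity, simplicity) take the carrier as an argument.
\<close>

locale fd_lie_algebra = vector_space scale
  for scale :: "complex \<Rightarrow> 'g::ab_group_add \<Rightarrow> 'g" +
  fixes br :: "'g \<Rightarrow> 'g \<Rightarrow> 'g"
  assumes finite_dimensional: "\<exists>B. finite B \<and> span B = UNIV"
    and br_linear_right: "Vector_Spaces.linear scale scale (\<lambda>y. br x y)"
    and br_linear_left: "Vector_Spaces.linear scale scale (\<lambda>x. br x y)"
    and br_alternating: "br x x = 0"
    and jacobi: "br x (br y z) + br y (br z x) + br z (br x y) = 0"
begin

definition br_span :: "'g set \<Rightarrow> 'g set \<Rightarrow> 'g set" where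
  "br_span A B = span {br a b | a b. a \<in> A \<and> b \<in> B}"

definition lie_subalgebra :: "'g set \<Rightarrow> bool" where
  "lie_subalgebra A \<longleftrightarrow> subspace A \<and> (\<forall>x\<in>A. \<forall>y\<in>A. br x y \<in> A)"

definition lie_ideal :: "'g set \<Rightarrow> 'g set \<Rightarrow> bool" where
  "lie_ideal A I \<longleftrightarrow> subspace I \<and> I \<subseteq> A \<and> (\<forall>x\<in>A. \<forall>y\<in>I. br x y \<in> I)"

definition derived_series :: "'g set \<Rightarrow> nat \<Rightarrow> 'g set" where
  "derived_series A n = ((\<lambda>B. br_span B B) ^^ n) A"

definition solvable :: "'g set \<Rightarrow> bool" where
  "solvable A \<longleftrightarrow> (\<exists>n. derived_series A n = {0})"

text \<open>\<open>is_radical A R\<close>: \<open>R\<close> is the largest solvable ideal of the Lie algebra \<open>A\<close>.\<close>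

definition is_radical :: "'g set \<Rightarrow> 'g set \<Rightarrow> bool" where
  "is_radical A R \<longleftrightarrow> lie_ideal A R \<and> solvable R \<and>
     (\<forall>I. lie_ideal A I \<and> solvable I \<longrightarrow> I \<subseteq> R)"

definition semisimple :: "'g set \<Rightarrow> bool" where
  "semisimple A \<longleftrightarrow> is_radical A {0}"

definition simple_lie :: "'g set \<Rightarrow> bool" where
  "simple_lie A \<longleftrightarrow> lie_subalgebra A \<and> br_span A A \<noteq> {0} \<and>
     (\<forall>I. lie_ideal A I \<longrightarrow> I = {0} \<or> I = A)"

definition levi_decomposition :: "'g set \<Rightarrow> 'g set \<Rightarrow> bool" where
  "levi_decomposition L R \<longleftrightarrow> lie_subalgebra L \<and> semisimple L \<and> is_radical UNIV R \<and>
     L \<inter> R = {0} \<and> (\<forall>x. \<exists>l\<in>L. \<exists>r\<in>R. x = l + r)"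

definition center :: "'g set" where
  "center = {z. \<forall>x. br z x = 0}"

definition derivation :: "('g \<Rightarrow> 'g) \<Rightarrow> bool" where
  "derivation D \<longleftrightarrow> Vector_Spaces.linear scale scale D \<and>
     (\<forall>x y. D (br x y) = br (D x) y + br x (D y))"

text \<open>The adjoint map of \<open>x\<close> is the partial application \<open>br x\<close>.\<close>

definition sympathetic :: bool where
  "sympathetic \<longleftrightarrow> center = {0} \<and> br_span UNIV UNIV = UNIV \<and>
     {D. derivation D} = range (\<lambda>x. br x)"

text \<open>Modules over a subalgebra \<open>L\<close> are subspaces on which \<open>L\<close> acts by the bracket.\<close>

definition lie_module :: "'g set \<Rightarrow> 'g set \<Rightarrow> bool" where
  "lie_module L W \<longleftrightarrow> subspace W \<and> (\<forall>x\<in>L. \<forall>w\<in>W. br x w \<in> W)"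

definition simple_module :: "'g set \<Rightarrow> 'g set \<Rightarrow> bool" where
  "simple_module L W \<longleftrightarrow> lie_module L W \<and> W \<noteq> {0} \<and>
     (\<forall>U. lie_module L U \<and> U \<subseteq> W \<longrightarrow> U = {0} \<or> U = W)"

definition direct_sum :: "'i set \<Rightarrow> ('i \<Rightarrow> 'g set) \<Rightarrow> 'g set \<Rightarrow> bool" where
  "direct_sum I V W \<longleftrightarrow> finite I \<and> (\<forall>i\<in>I. subspace (V i)) \<and>
     W = {\<Sum>i\<in>I. v i | v. \<forall>i\<in>I. v i \<in> V i} \<and>
     (\<forall>v. (\<forall>i\<in>I. v i \<in> V i) \<and> (\<Sum>i\<in>I. v i) = 0 \<longrightarrow> (\<forall>i\<in>I. v i = 0))"

end

end

theory Submission
  imports Defs "HOL-Computational_Algebra.Fundamental_Theorem_Algebra"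
begin

text \<open>
  A perfect Lie algebra acts on each of its chief factors with trivial action of the radical, so
  the radical \<open>h\<close> is nilpotent and the lower central series ranks the summands \<open>V i\<close>
  so that a product \<open>[V i, V j] = V p\<close> strictly raises the rank. If there are at most three
  summands, complex weights \<open>w\<close>, not all zero, exist with \<open>w i + w j = w p\<close> for all products:
  the only obstruction would be \<open>[V a, V a] = V b\<close> together with \<open>[V b, V b] = V c\<close>, and then the
  Jacobi identity makes \<open>[V a, [V a, V b]]\<close> nonzero, giving four ranks. The weights define a
  derivation vanishing on \<open>L\<close>; it is \<open>ad x\<close> with \<open>x\<close> centralizing \<open>L\<close>, hence \<open>x \<in> h\<close>, so it is
  nilpotent on \<open>h\<close>, while having a nonzero eigenvalue.
\<close>

section \<open>Linear algebra modulo a subspace\<close>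

locale fd_complex_space = finite_dimensional_vector_space scale Basis
  for scale :: "complex \<Rightarrow> 'g::ab_group_add \<Rightarrow> 'g" (infixr \<open>*s\<close> 75) and Basis
begin

lemma no_ascending_subspace_chain:
  assumes "\<And>n. subspace (G n)" and "\<And>n::nat. G n \<subset> G (Suc n)"
  shows False
proof -
  have "n \<le> dim (G n)" for n
  proof (induction n)
    case (Suc n)
    have "span (G n) \<subset> span (G (Suc n))"
      using assms by (simp add: span_eq_iff[THEN iffD2])
    from dim_psubset[OF this] Suc show ?case
      by linarith
  qed simp
  from this[of "Suc dimension"] show False
    using dim_subset_UNIV[of "G (Suc dimension)"] by simp
qed

lemma no_descending_subspace_chain:
  assumes "\<And>n. subspace (G n)" and "\<And>n::nat. G (Suc n) \<subset> G n"
  shows False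
proof -
  have "dim (G n) + n \<le> dimension" for n
  proof (induction n)
    case (Suc n)
    have "span (G (Suc n)) \<subset> span (G n)"
      using assms by (simp add: span_eq_iff[THEN iffD2])
    from dim_psubset[OF this] Suc show ?case
      by linarith
  qed (simp add: dim_subset_UNIV)
  from this[of "Suc dimension"] show False by simp
qed

text \<open>The operator \<open>p(S)\<close> applied to a vector, evaluated by Horner's
  rule.\<close>

definition poly_apply :: "('g \<Rightarrow> 'g) \<Rightarrow> complex poly \<Rightarrow> 'g \<Rightarrow> 'g" where
  "poly_apply S p = fold_coeffs (\<lambda>a f v. a *s v + S (f v)) p (\<lambda>_. 0)"

lemma poly_apply_0 [simp]: "poly_apply S 0 v = 0"
  by (simp add: poly_apply_def)

context
  fixes S :: "'g \<Rightarrow> 'g"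
  assumes S: "Vector_Spaces.linear scale scale S"
begin

interpretation S: Vector_Spaces.linear scale scale S
  by (rule S)

lemma poly_apply_pCons [simp]: "poly_apply S (pCons a p) v = a *s v + S (poly_apply S p v)"
  by (cases "pCons a p = 0") (auto simp: poly_apply_def S.zero)

lemma poly_apply_add: "poly_apply S (p + q) v = poly_apply S p v + poly_apply S q v"
  by (induction p q rule: poly_induct2) (simp_all add: S.add algebra_simps)

lemma poly_apply_smult: "poly_apply S (smult c p) v = c *s poly_apply S p v"
  by (induction p) (simp_all add: S.scale algebra_simps)

lemma poly_apply_monom: "poly_apply S (monom c n) v = c *s (S ^^ n) v"
  by (induction n) (simp_all add: monom_Suc S.zero S.scale monom_0)

lemma poly_apply_linear_factor:
  "poly_apply S ([:- a, 1:] * p) v = S (poly_apply S p v) - a *s poly_apply S p v"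
proof -
  have "[:- a, 1:] * p = smult (- a) p + pCons 0 p"
    by simp
  then show ?thesis
    by (simp only: poly_apply_add poly_apply_smult poly_apply_pCons) simp
qed

text \<open>The degree bound is put on the coefficients so that \<open>n = 0\<close>, where only
  \<open>p = 0\<close> qualifies, needs no exception.\<close>

lemma span_orbit_poly:
  assumes "x \<in> span ((\<lambda>i. (S ^^ i) v) ` {..<n})"
  shows "\<exists>p. poly_apply S p v = x \<and> (\<forall>j\<ge>n. coeff p j = 0)"
  using assms
proof (induction rule: span_induct_alt)
  case base
  show ?case by (intro exI[of _ 0]) simp
next
  case (step c x y)
  then obtain i p where "x = (S ^^ i) v" "i < n" "poly_apply S p v = y" "\<forall>j\<ge>n. coeff p j = 0"
    by auto
  then show ?case
    by (intro exI[of _ "monom c i + p"]) (auto simp: poly_apply_add poly_apply_monom)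
qed

end

text \<open>Modulo \<open>W\<close>, the commutator of \<open>T\<close> and \<open>A\<close> is
  \<open>Z\<close>, which commutes with \<open>A\<close>. Commuting with \<open>T\<close> acts as a
  derivation on powers of \<open>A\<close>, so the commutator of \<open>T\<close> with
  \<open>A ^^ (n + 1)\<close> is \<open>(n + 1) Z A ^^ n\<close>.\<close>

lemma commutator_funpow:
  assumes W: "subspace W"
    and A: "Vector_Spaces.linear scale scale A"
    and AU: "\<And>u. u \<in> U \<Longrightarrow> A u \<in> U" and AW: "\<And>u. u \<in> W \<Longrightarrow> A u \<in> W"
    and TA: "\<And>u. u \<in> U \<Longrightarrow> T (A u) - A (T u) - Z u \<in> W"
    and ZA: "\<And>u. u \<in> U \<Longrightarrow> A (Z u) - Z (A u) \<in> W"
    and v: "v \<in> U"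
  shows "T ((A ^^ Suc n) v) - (A ^^ Suc n) (T v) - of_nat (Suc n) *s Z ((A ^^ n) v) \<in> W"
proof (induction n)
  case 0
  then show ?case using TA v by simp
next
  case (Suc n)
  interpret A: Vector_Spaces.linear scale scale A by (rule A)
  define c :: complex where "c = of_nat (Suc n)"
  have c2: "of_nat (Suc (Suc n)) = c + 1"
    by (simp add: c_def)
  have U: "(A ^^ m) v \<in> U" for m
    by (induction m) (auto simp: v AU)
  have "T ((A ^^ Suc (Suc n)) v) - (A ^^ Suc (Suc n)) (T v)
          - of_nat (Suc (Suc n)) *s Z ((A ^^ Suc n) v)
      = (T (A ((A ^^ Suc n) v)) - A (T ((A ^^ Suc n) v)) - Z ((A ^^ Suc n) v))
        + A (T ((A ^^ Suc n) v) - (A ^^ Suc n) (T v) - c *s Z ((A ^^ n) v))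
        + c *s (A (Z ((A ^^ n) v)) - Z (A ((A ^^ n) v)))"
    unfolding c2 by (simp add: A.add A.diff A.scale algebra_simps)
  also have "\<dots> \<in> W"
    by (intro subspace_add[OF W] subspace_scale[OF W] AW TA ZA U Suc[folded c_def])
  finally show ?case .
qed

text \<open>An eigenvector on the image of \<open>U\<close> modulo \<open>W\<close>, phrased through
  representatives. In finite dimension the orbit of a vector under \<open>S\<close> is dependent, so
  a nonzero polynomial in \<open>S\<close> kills the vector, and complex polynomials split.\<close>

lemma eigenvector_mod_subspace:
  assumes U: "subspace U" and W: "subspace W" and UW: "\<not> U \<subseteq> W"
    and S: "Vector_Spaces.linear scale scale S"
    and SU: "\<And>u. u \<in> U \<Longrightarrow> S u \<in> U"
  shows "\<exists>a v. v \<in> U \<and> v \<notin> W \<and> S v - scale a v \<in> W"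
proof -
  interpret S: Vector_Spaces.linear scale scale S by (rule S)
  obtain v where v: "v \<in> U" "v \<notin> W" using UW by auto
  define G where "G n = span ((\<lambda>i. (S ^^ i) v) ` {..<n})" for n :: nat
  have "\<exists>n. (S ^^ n) v \<in> G n"
  proof (rule ccontr)
    assume H: "\<nexists>n. (S ^^ n) v \<in> G n"
    have "G n \<subset> G (Suc n)" for n
    proof -
      have "G n \<subseteq> G (Suc n)" unfolding G_def by (intro span_mono) auto
      moreover have "(S ^^ n) v \<in> G (Suc n)" unfolding G_def by (intro span_base) auto
      ultimately show ?thesis using H by auto
    qed
    then show False
      using no_ascending_subspace_chain[of G] by (simp add: G_def)
  qed
  then obtain n p where p: "poly_apply S p v = (S ^^ n) v" "\<forall>j\<ge>n. coeff p j = 0"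
    using span_orbit_poly[OF S] unfolding G_def by blast
  \<comment> \<open>The dependence \<open>S^n v = p(S) v\<close> as a monic polynomial
    \<open>q\<close> that annihilates \<open>v\<close>.\<close>
  define q where "q = monom 1 n + smult (- 1) p"
  have "coeff q n = 1" using p(2) by (simp add: q_def)
  then have "q \<noteq> 0" by auto
  moreover have "poly_apply S q v = 0"
    using p(1) by (simp only: q_def poly_apply_add[OF S] poly_apply_smult[OF S] poly_apply_monom[OF S]) simp
  then have "poly_apply S q v \<in> W" using subspace_0[OF W] by simp
  ultimately show ?thesis
  \<comment> \<open>Linear factors are split off while the cofactor still sends \<open>v\<close>
    into \<open>W\<close>; the first cofactor that does not yields the eigenvector. One must occur,
    since a nonzero constant cannot send \<open>v\<close> into \<open>W\<close>.\<close>
  proof (induction "degree q" arbitrary: q)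
    case 0
    then obtain c where "q = [:c:]" "c \<noteq> 0"
      by (metis degree_eq_zeroE pCons_eq_0_iff)
    with 0 have "c *s v \<in> W"
      using S.zero by (simp add: poly_apply_pCons[OF S])
    from subspace_scale[OF W this, of "inverse c"] have "v \<in> W"
      using \<open>c \<noteq> 0\<close> by simp
    with v show ?case by simp
  next
    case (Suc m)
    have "\<not> constant (poly q)"
      using Suc by (simp add: constant_degree)
    then obtain a where "poly q a = 0"
      using fundamental_theorem_of_algebra by blast
    then obtain r where r: "q = [:- a, 1:] * r"
      by (auto simp: poly_eq_0_iff_dvd)
    with Suc have r0: "r \<noteq> 0" by auto
    have "degree q = Suc (degree r)"
      unfolding r by (subst degree_mult_eq) (use r0 in auto)
    with Suc have dr: "m = degree r" by simp
    have rU: "poly_apply S r v \<in> U" for r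
      by (induction r) (auto simp: poly_apply_pCons[OF S] SU v intro!: subspace_add subspace_scale subspace_0 U)
    show ?case
    proof (cases "poly_apply S r v \<in> W")
      case True
      then show ?thesis using Suc(1)[OF dr r0] by simp
    next
      case False
      have "S (poly_apply S r v) - a *s poly_apply S r v \<in> W"
        using Suc.prems(2) unfolding r poly_apply_linear_factor[OF S] .
      then show ?thesis using False rU by blast
    qed
  qed
qed

text \<open>If \<open>Z\<close> were injective modulo \<open>W\<close>, then for a shift \<open>A\<close> of \<open>S\<close> that is singular modulo \<open>W\<close>,
  \<open>T\<close> would turn a vector killed by \<open>A ^^ (n + 1)\<close> but not by \<open>A ^^ n\<close> into one whose exact
  height is larger by one, so heights would be unbounded.\<close>

lemma commutator_singular_mod_subspace:
  assumes U: "subspace U" and W: "subspace W" and UW: "\<not> U \<subseteq> W"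
    and S: "Vector_Spaces.linear scale scale S"
    and T: "Vector_Spaces.linear scale scale T"
    and Z: "Vector_Spaces.linear scale scale Z"
    and SU: "\<And>u. u \<in> U \<Longrightarrow> S u \<in> U" and SW: "\<And>u. u \<in> W \<Longrightarrow> S u \<in> W"
    and TU: "\<And>u. u \<in> U \<Longrightarrow> T u \<in> U" and TW: "\<And>u. u \<in> W \<Longrightarrow> T u \<in> W"
    and ZW: "\<And>u. u \<in> W \<Longrightarrow> Z u \<in> W"
    and TS: "\<And>u. u \<in> U \<Longrightarrow> T (S u) - S (T u) - Z u \<in> W"
    and ZS: "\<And>u. u \<in> U \<Longrightarrow> S (Z u) - Z (S u) \<in> W"
  shows "\<exists>v\<in>U - W. Z v \<in> W"
proof (rule ccontr)
  assume inj: "\<not> ?thesis"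
  interpret S: Vector_Spaces.linear scale scale S by (rule S)
  interpret T: Vector_Spaces.linear scale scale T by (rule T)
  interpret Z: Vector_Spaces.linear scale scale Z by (rule Z)
  obtain a v where v: "v \<in> U" "v \<notin> W" "S v - scale a v \<in> W"
    using eigenvector_mod_subspace[OF U W UW S SU] by blast
  \<comment> \<open>Subtracting an eigenvalue makes the operator singular modulo \<open>W\<close>:
    \<open>v\<close> starts the induction on heights.\<close>
  define A where "A u = S u - scale a u" for u
  interpret A: Vector_Spaces.linear scale scale A
    by unfold_locales (simp_all add: A_def S.add S.scale algebra_simps)
  have A: "Vector_Spaces.linear scale scale A" by (rule A.linear_axioms)
  have AU: "A u \<in> U" if "u \<in> U" for u
    unfolding A_def using that by (intro subspace_diff subspace_scale U SU)
  have AW: "A u \<in> W" if "u \<in> W" for u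
    unfolding A_def using that by (intro subspace_diff subspace_scale W SW)
  have TA: "T (A u) - A (T u) - Z u \<in> W" if "u \<in> U" for u
    using TS[OF that] by (simp add: A_def T.diff T.scale algebra_simps)
  have ZA: "A (Z u) - Z (A u) \<in> W" if "u \<in> U" for u
    using ZS[OF that] by (simp add: A_def Z.diff Z.scale algebra_simps)
  have cong: "x \<in> W \<longleftrightarrow> y \<in> W" if "x - y \<in> W" for x y
  proof -
    have "x = (x - y) + y" "y = x - (x - y)" by simp_all
    then show ?thesis using that subspace_add[OF W] subspace_diff[OF W] by metis
  qed
  have ApU: "(A ^^ n) u \<in> U" if "u \<in> U" for u n
    using that by (induction n) (auto simp: AU)
  have ApW: "(A ^^ n) u \<in> W" if "u \<in> W" for u n
    using that by (induction n) (auto simp: AW)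
  \<comment> \<open>As \<open>T\<close> maps \<open>(A ^^ Suc n) u\<close> into \<open>W\<close>,
    the commutator formula gives \<open>(A ^^ Suc n) (T u) = - (n + 1) Z ((A ^^ n) u)\<close> modulo
    \<open>W\<close>, and \<open>n + 1\<close> is invertible in characteristic zero.\<close>
  have shift: "(A ^^ Suc n) (T u) \<in> W \<longleftrightarrow> Z ((A ^^ n) u) \<in> W"
    if u: "u \<in> U" and u': "(A ^^ Suc n) u \<in> W" for u n
  proof -
    have "T ((A ^^ Suc n) u) - (A ^^ Suc n) (T u) - scale (of_nat (Suc n)) (Z ((A ^^ n) u)) \<in> W"
        by (rule commutator_funpow[where U = U and W = W and T = T and A = A and Z = Z, OF W A AU AW TA ZA u])
    then have "T ((A ^^ Suc n) u) - ((A ^^ Suc n) (T u) + scale (of_nat (Suc n)) (Z ((A ^^ n) u))) \<in> W"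
      by (simp add: algebra_simps)
    then have 1: "(A ^^ Suc n) (T u) + scale (of_nat (Suc n)) (Z ((A ^^ n) u)) \<in> W"
      using cong TW[OF u'] by blast
    have 2: "scale (of_nat (Suc n)) (Z ((A ^^ n) u)) \<in> W \<longleftrightarrow> Z ((A ^^ n) u) \<in> W"
    proof
      assume "scale (of_nat (Suc n)) (Z ((A ^^ n) u)) \<in> W"
      from subspace_scale[OF W this, of "inverse (of_nat (Suc n))"]
      show "Z ((A ^^ n) u) \<in> W" by (simp del: of_nat_Suc)
    qed (intro subspace_scale W)
    show ?thesis
      using 1 2 subspace_diff[OF W] subspace_add[OF W]
      by (metis add_diff_cancel_left' add_diff_cancel_right')
  qed
  have ex: "\<exists>u\<in>U. (A ^^ n) u \<notin> W \<and> (A ^^ Suc n) u \<in> W" for n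
  proof (induction n)
    case 0
    show ?case using v by (auto simp: A_def)
  next
    case (Suc n)
    then obtain u where u: "u \<in> U" "(A ^^ n) u \<notin> W" "(A ^^ Suc n) u \<in> W" by blast
    have "(A ^^ Suc n) (T u) \<notin> W"
      using shift[OF u(1,3)] inj u(2) ApU[OF u(1)] by blast
    moreover have u4: "(A ^^ Suc (Suc n)) u \<in> W"
      using AW[OF u(3)] by simp
    then have "(A ^^ Suc (Suc n)) (T u) \<in> W"
      using shift[OF u(1) u4] ZW u(3) by blast
    ultimately show ?case using TU[OF u(1)] by blast
  qed
  \<comment> \<open>The kernels of the powers of \<open>A\<close> modulo \<open>W\<close>; vectors
    of every exact height make them grow forever.\<close>
  define G where "G n = {u \<in> U. (A ^^ n) u \<in> W}" for n
  have Apl: "(A ^^ n) (x + y) = (A ^^ n) x + (A ^^ n) y" "(A ^^ n) (scale c x) = scale c ((A ^^ n) x)"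
      "(A ^^ n) 0 = 0" for n x y c
    by (induction n) (simp_all add: A.add A.scale A.zero)
  have "subspace (G n)" for n
    unfolding G_def using U W by (auto simp: subspace_def Apl)
  moreover have "G n \<subset> G (Suc n)" for n
  proof -
    have "G n \<subseteq> G (Suc n)" unfolding G_def using AW by auto
    then show ?thesis using ex[of n] unfolding G_def by blast
  qed
  ultimately show False by (rule no_ascending_subspace_chain)
qed

end

section \<open>Weights on at most three ranked indices\<close>

text \<open>Here \<open>m i j p\<close> abstracts a nonzero product \<open>[V i, V j] = V p\<close>,
  and \<open>jac\<close> is what the Jacobi identity leaves of a square of a square. Ranks grow
  along products, so three indices permit either the chain \<open>a\<close>, \<open>a a\<close>,
  \<open>a (a a)\<close>, or only products whose factors are not themselves products.\<close>

lemma additive_weights_exist: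
  fixes r :: "'i \<Rightarrow> nat" and m :: "'i \<Rightarrow> 'i \<Rightarrow> 'i \<Rightarrow> bool"
  assumes I: "finite I" "card I \<le> 3" "I \<noteq> {}"
    and mI: "\<And>i j p. m i j p \<Longrightarrow> i \<in> I \<and> j \<in> I \<and> p \<in> I"
    and sym: "\<And>i j p. m i j p \<Longrightarrow> m j i p"
    and uniq: "\<And>i j p q. m i j p \<Longrightarrow> m i j q \<Longrightarrow> p = q"
    and rank: "\<And>i j p. m i j p \<Longrightarrow> r i < r p"
    and jac: "\<And>a b c. m a a b \<Longrightarrow> m b b c \<Longrightarrow> \<exists>d e. m a b d \<and> m a d e"
  shows "\<exists>w :: 'i \<Rightarrow> complex. (\<exists>i\<in>I. w i \<noteq> 0) \<and> (\<forall>i j p. m i j p \<longrightarrow> w i + w j = w p)"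
proof -
  \<comment> \<open>Three strictly increasing ranks already use up all of \<open>I\<close>.\<close>
  have all3: "x \<in> {a, b, c}" if "r a < r b" "r b < r c" "a \<in> I" "b \<in> I" "c \<in> I" "x \<in> I" for a b c x
  proof (rule ccontr)
    assume "x \<notin> {a, b, c}"
    moreover have "a \<noteq> b" "a \<noteq> c" "b \<noteq> c" using that by auto
    ultimately have "card {a, b, c, x} = 4" by auto
    moreover have "card {a, b, c, x} \<le> card I" using that I by (intro card_mono) auto
    ultimately show False using I(2) by simp
  qed
  \<comment> \<open>Through \<open>jac\<close>, two consecutive squares would force the four
    increasing ranks of \<open>a\<close>, \<open>b\<close>, \<open>d\<close>,
    \<open>e\<close>.\<close>
  have nosq: "\<not> (m a a b \<and> m b b c)" for a b c
  proof
    assume "m a a b \<and> m b b c"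
    then obtain d e where d: "m a a b" "m a b d" "m a d e" using jac by blast
    then have "r a < r b" "r b < r d" "r d < r e" using rank sym by blast+
    moreover have "e \<in> {a, b, d}" using all3[of a b d e] calculation d mI by blast
    ultimately show False by auto
  qed
  show ?thesis
  proof (cases "\<exists>a b c. m a a b \<and> m a b c")
    case True
    then obtain a b c where abc: "m a a b" "m a b c" by blast
    then have lt: "r a < r b" "r b < r c" using rank sym by blast+
    have all: "x \<in> I \<Longrightarrow> x \<in> {a, b, c}" for x using all3[of a b c x] lt abc mI by blast
    \<comment> \<open>The degrees in the chain \<open>b = a a\<close>, \<open>c = a b\<close>. The
      other products compatible with the ranks, \<open>a a = c\<close> and \<open>b b = c\<close>,
      are excluded by \<open>uniq\<close> and \<open>nosq\<close>.\<close>
    define w :: "'i \<Rightarrow> complex" where "w i = (if i = a then 1 else if i = b then 2 else 3)" for i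
    have "w i + w j = w p" if m: "m i j p" for i j p
    proof -
      have *: "r i < r p" "r j < r p" "i \<in> {a, b, c}" "j \<in> {a, b, c}" "p \<in> {a, b, c}"
        using rank sym m mI all by blast+
      consider "p = b" "i = a" "j = a" | "p = c" "i = a" "j = a" | "p = c" "i = a" "j = b"
        | "p = c" "i = b" "j = a" | "p = c" "i = b" "j = b"
        using * lt by auto
      then show ?thesis
      proof cases
        case 2
        then show ?thesis using uniq m abc(1) lt by blast
      next
        case 5
        then show ?thesis using nosq m abc(1) by blast
      qed (use lt in \<open>auto simp: w_def\<close>)
    qed
    moreover have "w a \<noteq> 0" "a \<in> I" using abc mI by (auto simp: w_def)
    ultimately show ?thesis by blast
  next
    case False
    \<comment> \<open>Products get weight 2, all other indices weight 1; it remains to see that no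
      factor is itself a product.\<close>
    define w :: "'i \<Rightarrow> complex" where "w i = (if \<exists>x y. m x y i then 2 else 1)" for i
    have 1: "w i = 1" if m: "m i j p" for i j p
    proof (rule ccontr)
      assume "w i \<noteq> 1"
      then obtain x y where xy: "m x y i" by (auto simp: w_def split: if_splits)
      have lt: "r x < r i" "r y < r i" "r i < r p" "r j < r p" using rank sym xy m by blast+
      \<comment> \<open>The indices \<open>x\<close>, \<open>i\<close>, \<open>p\<close> exhaust
        \<open>I\<close>, so \<open>i = x x\<close>. Then \<open>j = x\<close> gives the chain of
        the first case, and \<open>j = i\<close> gives two consecutive squares.\<close>
      have "y \<in> {x, i, p}" "j \<in> {x, i, p}"
        using all3[of x i p] lt xy m mI by blast+
      then have "y = x" "j = x \<or> j = i" using lt by auto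
      then show False using False nosq xy m sym by blast
    qed
    have "w i + w j = w p" if m: "m i j p" for i j p
      using 1[OF m] 1[OF sym[OF m]] m by (auto simp: w_def)
    moreover have "w i \<noteq> 0" for i by (simp add: w_def)
    ultimately show ?thesis using I(3) by blast
  qed
qed

section \<open>Brackets and ideals\<close>

context fd_lie_algebra
begin

text \<open>A finite spanning set contains a basis; fixing one inside a proof gives access to
  dimension counting.\<close>

lemma obtain_fd_complex_space: obtains B where "fd_complex_space scale B"
proof -
  obtain F where F: "finite F" "span F = UNIV"
    using finite_dimensional by blast
  obtain B where B: "B \<subseteq> F" "independent B" "F \<subseteq> span B"
    by (rule maximal_independent_subset)
  have "span B = UNIV"
    using F(2) B(3) by (metis span_minimal subspace_span top.extremum_uniqueI)
  moreover have "finite B"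
    using B(1) F(1) finite_subset by blast
  ultimately have "fd_complex_space scale B"
    using B(2) by unfold_locales
  then show thesis by (rule that)
qed

lemma br_add_right: "br x (y + z) = br x y + br x z"
  and br_scale_right: "br x (scale c y) = scale c (br x y)"
  and br_zero_right [simp]: "br x 0 = 0"
  and br_sum_right: "br x (sum f I) = (\<Sum>i\<in>I. br x (f i))"
proof -
  interpret R: Vector_Spaces.linear scale scale "br x" by (rule br_linear_right)
  show "br x (y + z) = br x y + br x z" "br x (scale c y) = scale c (br x y)" "br x 0 = 0"
    "br x (sum f I) = (\<Sum>i\<in>I. br x (f i))"
    by (simp_all add: R.add R.scale R.zero R.sum)
qed

lemma br_add_left: "br (x + y) z = br x z + br y z"
  and br_scale_left: "br (scale c x) z = scale c (br x z)"
  and br_zero_left [simp]: "br 0 z = 0"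
  and br_sum_left: "br (sum f I) z = (\<Sum>i\<in>I. br (f i) z)"
proof -
  interpret R: Vector_Spaces.linear scale scale "\<lambda>x. br x z" by (rule br_linear_left)
  show "br (x + y) z = br x z + br y z" "br (scale c x) z = scale c (br x z)" "br 0 z = 0"
    "br (sum f I) z = (\<Sum>i\<in>I. br (f i) z)"
    by (simp_all add: R.add R.scale R.zero R.sum)
qed

lemma br_swap: "br x y = - br y x"
proof -
  have "br (x + y) (x + y) = br x y + br y x"
    unfolding br_add_left br_add_right by (simp add: br_alternating)
  then have "br x y + br y x = 0" by (simp add: br_alternating)
  then show ?thesis by (simp add: eq_neg_iff_add_eq_0)
qed

lemma br_minus_right: "br x (- y) = - br x y"
  using br_scale_right[of x "- 1" y] by simp

lemma br_leibniz: "br x (br y z) = br (br x y) z + br y (br x z)"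
proof -
  have "br y (br z x) = - br y (br x z)" "br z (br x y) = - br (br x y) z"
    by (metis br_swap br_minus_right) (rule br_swap)
  then show ?thesis using jacobi[of x y z] by (simp add: algebra_simps)
qed

lemma lie_ideal_UNIV_iff: "lie_ideal UNIV I \<longleftrightarrow> subspace I \<and> (\<forall>x. \<forall>y\<in>I. br x y \<in> I)"
  by (auto simp: lie_ideal_def)

lemma br_span_subset_iff: "subspace C \<Longrightarrow> br_span A B \<subseteq> C \<longleftrightarrow> (\<forall>a\<in>A. \<forall>b\<in>B. br a b \<in> C)"
  unfolding br_span_def by (rule iffI; (rule span_minimal)?) (auto intro: span_base)

lemma subspace_br_span [simp]: "subspace (br_span A B)"
  by (simp add: br_span_def)

lemma br_in_br_span: "a \<in> A \<Longrightarrow> b \<in> B \<Longrightarrow> br a b \<in> br_span A B"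
  unfolding br_span_def by (intro span_base) auto

lemma br_span_commute: "br_span A B = br_span B A"
proof -
  have "br a b \<in> br_span B A" if "a \<in> A" "b \<in> B" for a b A B
    using subspace_neg[OF subspace_br_span br_in_br_span[OF that(2,1)]] br_swap[of a b] by simp
  then have "br_span A B \<subseteq> br_span B A" for A B
    by (simp add: br_span_subset_iff)
  then show ?thesis by blast
qed

lemma subspace_vimage_br: "subspace C \<Longrightarrow> subspace {y. br x y \<in> C}"
  by (auto simp: subspace_def br_add_right br_scale_right)

lemma subspace_vimage_br_left: "subspace C \<Longrightarrow> subspace {x. br x y \<in> C}"
  by (auto simp: subspace_def br_add_left br_scale_left)

lemma lie_ideal_br_span:
  assumes "lie_ideal UNIV A" "lie_ideal UNIV B"
  shows "lie_ideal UNIV (br_span A B)"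
proof -
  have "br_span A B \<subseteq> {y. br x y \<in> br_span A B}" for x
  proof (subst br_span_subset_iff)
    show "\<forall>a\<in>A. \<forall>b\<in>B. br a b \<in> {y. br x y \<in> br_span A B}"
      using assms by (auto simp: br_leibniz[of x] lie_ideal_UNIV_iff intro!: subspace_add br_in_br_span)
  qed (simp add: subspace_vimage_br)
  then show ?thesis by (auto simp: lie_ideal_UNIV_iff)
qed

text \<open>By \<open>[z, [x, v]] = [x, [z, v]] - [[x, z], v]\<close>, the only obstruction is the
  term with \<open>[x, z]\<close>, and \<open>C\<close> removes it for vectors already killed modulo
  \<open>W\<close>.\<close>

lemma lie_ideal_centralizer_mod:
  assumes "lie_ideal UNIV U" "lie_ideal UNIV W"
    and C: "\<And>x z v. z \<in> C \<Longrightarrow> v \<in> U \<Longrightarrow> (\<forall>y\<in>C. br y v \<in> W) \<Longrightarrow> br (br x z) v \<in> W"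
  shows "lie_ideal UNIV {v\<in>U. \<forall>z\<in>C. br z v \<in> W}"
proof -
  have "br z (br x v) \<in> W" if "v \<in> U" "\<forall>z\<in>C. br z v \<in> W" "z \<in> C" for x z v
  proof -
    have "br z (br x v) = br x (br z v) - br (br x z) v"
      by (simp add: br_leibniz[of x])
    then show ?thesis
      using assms that by (auto simp: lie_ideal_UNIV_iff intro!: subspace_diff)
  qed
  moreover have "subspace {v\<in>U. \<forall>z\<in>C. br z v \<in> W}"
    using assms by (auto simp: lie_ideal_UNIV_iff subspace_def br_add_right br_scale_right)
  ultimately show ?thesis
    using assms by (auto simp: lie_ideal_UNIV_iff)
qed

text \<open>The generalized kernel of \<open>ad z\<close> modulo \<open>W\<close>. Since
  \<open>[x, z]\<close> lies in \<open>B\<close>, it commutes with \<open>z\<close> modulo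
  \<open>W\<close>, so \<open>commutator_funpow\<close> shows that applying \<open>ad x\<close>
  raises the nilpotency height by at most one.\<close>

lemma lie_ideal_nil_mod:
  assumes U: "lie_ideal UNIV U" and W: "lie_ideal UNIV W" and B: "lie_ideal UNIV B"
    and BB: "\<And>a b v. a \<in> B \<Longrightarrow> b \<in> B \<Longrightarrow> v \<in> U \<Longrightarrow> br (br a b) v \<in> W"
    and z: "z \<in> B"
  shows "lie_ideal UNIV {v\<in>U. \<exists>n. (br z ^^ n) v \<in> W}"
proof -
  obtain E where "fd_complex_space scale E" by (rule obtain_fd_complex_space)
  then interpret fd_complex_space scale E .
  have sU: "subspace U" and sW: "subspace W"
    and bU: "\<And>x v. v \<in> U \<Longrightarrow> br x v \<in> U" and bW: "\<And>x v. v \<in> W \<Longrightarrow> br x v \<in> W"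
    using U W by (auto simp: lie_ideal_UNIV_iff)
  have mono: "(br z ^^ (n + m)) v \<in> W" if "(br z ^^ n) v \<in> W" for n m v
    using that by (induction m) (auto simp: bW)
  have pl: "(br z ^^ n) (x + y) = (br z ^^ n) x + (br z ^^ n) y"
      "(br z ^^ n) (scale c x) = scale c ((br z ^^ n) x)" for n x y c
    by (induction n) (simp_all add: br_add_right br_scale_right)
  have "\<exists>n. (br z ^^ n) (x + y) \<in> W" if "(br z ^^ n) x \<in> W" "(br z ^^ m) y \<in> W" for x y n m
    using mono[OF that(1), of m] mono[OF that(2), of n]
    by (intro exI[of _ "n + m"]) (simp add: pl add.commute subspace_add[OF sW])
  moreover have "\<exists>n. (br z ^^ n) (br x v) \<in> W" if v: "v \<in> U" and n: "(br z ^^ n) v \<in> W" for x v n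
  proof (intro exI[of _ "Suc n"])
    have "br x ((br z ^^ Suc n) v) - (br z ^^ Suc n) (br x v) - scale (of_nat (Suc n)) (br (br x z) ((br z ^^ n) v)) \<in> W"
    proof (rule commutator_funpow[where U = U])
      show "br x (br z u) - br z (br x u) - br (br x z) u \<in> W" for u
        using subspace_0[OF sW] by (simp add: br_leibniz[of x])
      show "br z (br (br x z) u) - br (br x z) (br z u) \<in> W" if "u \<in> U" for u
        using that BB B z by (simp add: br_leibniz[of z "br x z"] lie_ideal_UNIV_iff)
    qed (use sU sW bU bW v br_linear_right in auto)
    moreover have "br x ((br z ^^ Suc n) v) \<in> W" "scale (of_nat (Suc n)) (br (br x z) ((br z ^^ n) v)) \<in> W"
      using n by (auto intro!: bW subspace_scale sW)
    moreover have "b \<in> W" if "a - b - c \<in> W" "a \<in> W" "c \<in> W" for a b c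
    proof -
      have "b = a - (a - b - c) - c" by simp
      then show ?thesis using that subspace_diff[OF sW] by metis
    qed
    ultimately show "(br z ^^ Suc n) (br x v) \<in> W" by blast
  qed
  moreover have "\<exists>n. (br z ^^ n) 0 \<in> W"
    using subspace_0[OF sW] by (intro exI[of _ 0]) simp
  moreover have "\<exists>n. (br z ^^ n) (scale c x) \<in> W" if "(br z ^^ n) x \<in> W" for c x n
    using subspace_scale[OF sW that, of c] by (intro exI[of _ n]) (simp add: pl)
  ultimately show ?thesis
    using sU bU unfolding lie_ideal_UNIV_iff subspace_def mem_Collect_eq by blast
qed

section \<open>Action of a solvable ideal on chief factors\<close>

text \<open>The pair stands for the irreducible quotient \<open>U/W\<close> of the adjoint module;
  keeping both ideals avoids a quotient type.\<close>

definition chief_factor :: "'g set \<Rightarrow> 'g set \<Rightarrow> bool" where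
  "chief_factor U W \<longleftrightarrow> lie_ideal UNIV U \<and> lie_ideal UNIV W \<and> W \<subset> U \<and>
     (\<forall>I. lie_ideal UNIV I \<and> W \<subseteq> I \<and> I \<subseteq> U \<longrightarrow> I = W \<or> I = U)"

text \<open>The linear algebra result with \<open>S = ad y\<close>, \<open>T = ad x\<close> and
  \<open>Z = ad [x, y]\<close>; the assumption says that \<open>[x, y]\<close> commutes with
  \<open>y\<close> on \<open>U/W\<close>.\<close>

lemma chief_factor_commutator_singular:
  assumes UW: "chief_factor U W"
    and c: "\<And>v. v \<in> U \<Longrightarrow> br (br y (br x y)) v \<in> W"
  shows "\<exists>v\<in>U - W. br (br x y) v \<in> W"
proof -
  obtain E where "fd_complex_space scale E" by (rule obtain_fd_complex_space)
  then interpret fd_complex_space scale E .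
  have sU: "subspace U" and sW: "subspace W" and n: "\<not> U \<subseteq> W"
    and bU: "\<And>x v. v \<in> U \<Longrightarrow> br x v \<in> U" and bW: "\<And>x v. v \<in> W \<Longrightarrow> br x v \<in> W"
    using UW by (auto simp: chief_factor_def lie_ideal_UNIV_iff)
  show ?thesis
  proof (rule commutator_singular_mod_subspace[OF sU sW n br_linear_right br_linear_right br_linear_right])
    show "br x (br y u) - br y (br x u) - br (br x y) u \<in> W" for u
      using subspace_0[OF sW] by (simp add: br_leibniz[of x])
    show "br y (br (br x y) u) - br (br x y) (br y u) \<in> W" if "u \<in> U" for u
      using that c by (simp add: br_leibniz[of y "br x y"])
  qed (use bU bW in auto)
qed

text \<open>Each \<open>z = [x, y]\<close> commutes with \<open>y\<close> modulo \<open>W\<close>, hence is singular; its generalized kernel is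
  an ideal, so \<open>z\<close> is nilpotent on the factor, and commuting nilpotent operators have a common kernel.\<close>

lemma chief_factor_bracket_trivial:
  assumes UW: "chief_factor U W" and B: "lie_ideal UNIV B"
    and BB: "\<And>a b v. a \<in> B \<Longrightarrow> b \<in> B \<Longrightarrow> v \<in> U \<Longrightarrow> br (br a b) v \<in> W"
    and u: "u \<in> U" "y \<in> B"
  shows "br (br x y) u \<in> W"
proof -
  obtain E where "fd_complex_space scale E" by (rule obtain_fd_complex_space)
  then interpret fd_complex_space scale E .
  have sU: "subspace U" and sW: "subspace W" and iU: "lie_ideal UNIV U" and iW: "lie_ideal UNIV W"
    and sub: "W \<subset> U" and max: "\<And>I. lie_ideal UNIV I \<Longrightarrow> W \<subseteq> I \<Longrightarrow> I \<subseteq> U \<Longrightarrow> I = W \<or> I = U"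
    and bU: "\<And>x v. v \<in> U \<Longrightarrow> br x v \<in> U" and bW: "\<And>x v. v \<in> W \<Longrightarrow> br x v \<in> W"
    using UW by (auto simp: chief_factor_def lie_ideal_UNIV_iff)
  have bB: "\<And>x v. v \<in> B \<Longrightarrow> br x v \<in> B"
    using B by (auto simp: lie_ideal_UNIV_iff)
  define Y where "Y = {br x y | x y. y \<in> B}"
  have YB: "Y \<subseteq> B" using bB by (auto simp: Y_def)
  have nil: "\<exists>n. (br z ^^ n) v \<in> W" if z: "z \<in> Y" and v: "v \<in> U" for z v
  proof -
    obtain x y where xy: "z = br x y" "y \<in> B" using z by (auto simp: Y_def)
    have "\<exists>v\<in>U - W. br (br x y) v \<in> W"
      using xy YB z by (intro chief_factor_commutator_singular[OF UW] BB) auto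
    then obtain w where w: "w \<in> U" "w \<notin> W" "(br z ^^ 1) w \<in> W"
      using xy by auto
    let ?N = "{v\<in>U. \<exists>n. (br z ^^ n) v \<in> W}"
    have "lie_ideal UNIV ?N"
      using YB z by (intro lie_ideal_nil_mod[OF iU iW B BB]) auto
    moreover have "W \<subseteq> ?N"
      using sub by (auto intro: exI[of _ 0])
    moreover have "w \<in> ?N"
      using w by blast
    ultimately have "?N = U"
      using max[of ?N] w(2) by auto
    then show ?thesis using v by blast
  qed
  \<comment> \<open>A finite spanning part of \<open>Y\<close>, so that a common kernel vector can
    be built by adding one operator at a time.\<close>
  obtain F where F: "F \<subseteq> Y" "independent F" "Y \<subseteq> span F"
    by (rule maximal_independent_subset)
  have "finite F" using F(2) by (rule finiteI_independent)
  then have "\<exists>v\<in>U - W. \<forall>z\<in>F. br z v \<in> W" using F(1)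
  proof (induction F)
    case empty
    then show ?case using sub by auto
  next
    case (insert z F)
    then obtain v where v: "v \<in> U" "v \<notin> W" "\<forall>z\<in>F. br z v \<in> W" by auto
    \<comment> \<open>The last power of \<open>z\<close> that keeps \<open>v\<close> outside
      \<open>W\<close> gives a vector killed by \<open>z\<close>. It is still killed by the earlier
      operators, as they commute with \<open>z\<close> modulo \<open>W\<close>.\<close>
    define n where "n = (LEAST n. (br z ^^ n) v \<in> W)"
    have n: "(br z ^^ n) v \<in> W" and lt: "\<And>m. m < n \<Longrightarrow> (br z ^^ m) v \<notin> W"
      unfolding n_def using nil[of z v] insert.prems v(1)
      by (auto intro: LeastI_ex dest: not_less_Least)
    from n v(2) obtain m where m: "n = Suc m" by (cases n) auto
    have st: "(br z ^^ j) v \<in> U \<and> (\<forall>z'\<in>F. br z' ((br z ^^ j) v) \<in> W)" for j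
    proof (induction j)
      case (Suc j)
      have "br z' (br z u) \<in> W" if "z' \<in> F" "u \<in> U" "br z' u \<in> W" for z' u
      proof -
        have "br (br z' z) u \<in> W" using that insert.prems YB by (intro BB) auto
        moreover have "br z (br z' u) \<in> W" using that(3) by (rule bW)
        ultimately show ?thesis
          by (simp add: br_leibniz[of z'] subspace_add[OF sW])
      qed
      then show ?case using Suc bU by auto
    qed (use v in auto)
    show ?case
      using st[of m] lt[of m] n m by (intro bexI[of _ "(br z ^^ m) v"]) auto
  qed
  then obtain v where v: "v \<in> U" "v \<notin> W" "\<forall>z\<in>F. br z v \<in> W" by auto
  have "span F \<subseteq> {z. br z v \<in> W}"
    using v by (intro span_minimal subspace_vimage_br_left sW) auto
  then have vY: "\<forall>z\<in>Y. br z v \<in> W" using F(3) by auto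
  \<comment> \<open>The common kernel is an ideal because \<open>Y\<close> is stable under brackets
    with the whole algebra; being larger than \<open>W\<close>, it is \<open>U\<close>.\<close>
  let ?K = "{v\<in>U. \<forall>z\<in>Y. br z v \<in> W}"
  have "lie_ideal UNIV ?K"
  proof (rule lie_ideal_centralizer_mod[OF iU iW])
    show "br (br x z) v \<in> W" if "z \<in> Y" "v \<in> U" "\<forall>y\<in>Y. br y v \<in> W" for x z v
    proof -
      have "br x z \<in> Y" unfolding Y_def using that(1) YB by blast
      then show ?thesis using that(3) by blast
    qed
  qed
  moreover have "W \<subseteq> ?K" using sub bW by auto
  ultimately have "?K = U" using max[of ?K] v vY by auto
  then have "\<forall>z\<in>Y. br z u \<in> W" using u by blast
  then show ?thesis using u by (auto simp: Y_def)
qed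

lemma derived_series_Suc: "derived_series A (Suc n) = br_span (derived_series A n) (derived_series A n)"
  by (simp add: derived_series_def)

lemma lie_ideal_derived_series: "lie_ideal UNIV A \<Longrightarrow> lie_ideal UNIV (derived_series A n)"
  by (induction n) (simp_all add: derived_series_Suc lie_ideal_br_span, simp add: derived_series_def)

text \<open>Induction up the derived series of \<open>h\<close>, starting from its zero term. If the
  next term acts trivially on \<open>U/W\<close>, then so does the bracket of the whole algebra with
  the current term; it remains to pass to the current term itself.\<close>

lemma chief_factor_solvable_trivial:
  assumes UW: "chief_factor U W" and h: "lie_ideal UNIV h" "solvable h" "h \<subseteq> br_span UNIV h"
    and "x \<in> h" "u \<in> U"
  shows "br x u \<in> W"
proof -
  have sW: "subspace W" and bW: "\<And>x v. v \<in> W \<Longrightarrow> br x v \<in> W" and sub: "W \<subset> U"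
    and iU: "lie_ideal UNIV U" and iW: "lie_ideal UNIV W"
    and max: "\<And>I. lie_ideal UNIV I \<Longrightarrow> W \<subseteq> I \<Longrightarrow> I \<subseteq> U \<Longrightarrow> I = W \<or> I = U"
    using UW by (auto simp: chief_factor_def lie_ideal_UNIV_iff)
  define H where "H = derived_series h"
  have iH: "lie_ideal UNIV (H n)" for n
    unfolding H_def by (rule lie_ideal_derived_series[OF h(1)])
  obtain N where N: "H N = {0}"
    using h(2) by (auto simp: solvable_def H_def)
  have step: "\<forall>y\<in>H n. \<forall>u\<in>U. br y u \<in> W" if IH: "\<forall>y\<in>H (Suc n). \<forall>u\<in>U. br y u \<in> W" for n
  proof -
    have tr: "br (br x y) u \<in> W" if "y \<in> H n" "u \<in> U" for x y u
      by (rule chief_factor_bracket_trivial[OF UW iH[of n]])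
         (use that IH in \<open>auto simp: H_def derived_series_Suc intro: br_in_br_span\<close>)
    have "H n \<subseteq> {y. br y u \<in> W}" if u: "u \<in> U" for u
    proof (cases n)
      \<comment> \<open>The term \<open>h\<close> itself need not be spanned by brackets of its own
        elements; here \<open>h \<subseteq> br_span UNIV h\<close> takes over.\<close>
      case 0
      have "br_span UNIV h \<subseteq> {y. br y u \<in> W}"
        using tr u 0 by (subst br_span_subset_iff) (auto intro: subspace_vimage_br_left sW simp: H_def derived_series_def)
      then show ?thesis using h(3) 0 by (auto simp: H_def derived_series_def)
    next
      case (Suc m)
      have "br (br a b) u \<in> W" if ab: "a \<in> H m" "b \<in> H m" for a b
      proof -
        have z: "br a b \<in> H n"
          using ab by (simp add: Suc H_def derived_series_Suc br_in_br_span)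
        \<comment> \<open>A generator \<open>[a, b]\<close> commutes with the action of the whole
          algebra on \<open>U/W\<close>. Being a commutator that commutes with \<open>b\<close>, it
          is singular, so irreducibility makes it zero, as in Schur's lemma.\<close>
        obtain w where w: "w \<in> U - W" "br (br a b) w \<in> W"
          using chief_factor_commutator_singular[OF UW tr[OF z]] by blast
        let ?K = "{v\<in>U. \<forall>z\<in>{br a b}. br z v \<in> W}"
        have "lie_ideal UNIV ?K"
          by (rule lie_ideal_centralizer_mod[OF iU iW]) (use tr z in auto)
        moreover have "W \<subseteq> ?K" using sub bW by auto
        ultimately have "?K = U" using max[of ?K] w by auto
        then show ?thesis using u by blast
      qed
      then have "br_span (H m) (H m) \<subseteq> {y. br y u \<in> W}"
        by (subst br_span_subset_iff) (auto intro: subspace_vimage_br_left sW)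
      then show ?thesis by (simp add: Suc H_def derived_series_Suc)
    qed
    then show ?thesis by blast
  qed
  have "\<forall>y\<in>H N. \<forall>u\<in>U. br y u \<in> W"
    using N subspace_0[OF sW] by auto
  then have "\<forall>y\<in>H 0. \<forall>u\<in>U. br y u \<in> W"
    by (induction N) (use step in auto)
  then show ?thesis using assms by (auto simp: H_def derived_series_def)
qed

section \<open>Nilpotency of the radical\<close>

primrec lower_central :: "'g set \<Rightarrow> nat \<Rightarrow> 'g set" where
  "lower_central h 0 = h"
| "lower_central h (Suc n) = br_span h (lower_central h n)"

lemma lie_ideal_lower_central: "lie_ideal UNIV h \<Longrightarrow> lie_ideal UNIV (lower_central h n)"
  by (induction n) (simp_all add: lie_ideal_br_span)

lemma lower_central_Suc_subset: "lie_ideal UNIV h \<Longrightarrow> lower_central h (Suc n) \<subseteq> lower_central h n"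
  using lie_ideal_lower_central[of h n] by (simp add: br_span_subset_iff lie_ideal_UNIV_iff)

lemma lower_central_antimono: "lie_ideal UNIV h \<Longrightarrow> m \<le> n \<Longrightarrow> lower_central h n \<subseteq> lower_central h m"
  by (rule lift_Suc_antimono_le) (rule lower_central_Suc_subset)

text \<open>A nonzero term \<open>U\<close> of the series has a maximal smaller ideal
  \<open>W\<close>. On the chief factor \<open>U/W\<close> the ideal \<open>h\<close> acts
  trivially, so the next term lies in \<open>W\<close>; a series that never vanished would descend
  strictly forever.\<close>

lemma lower_central_vanishes:
  assumes h: "lie_ideal UNIV h" "solvable h" "h \<subseteq> br_span UNIV h"
  shows "\<exists>n. lower_central h n = {0}"
proof (rule ccontr)
  assume H: "\<nexists>n. lower_central h n = {0}"
  obtain E where "fd_complex_space scale E" by (rule obtain_fd_complex_space)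
  then interpret fd_complex_space scale E .
  have "lower_central h (Suc n) \<subset> lower_central h n" for n
  proof -
    let ?U = "lower_central h n"
    have iU: "lie_ideal UNIV ?U" by (rule lie_ideal_lower_central[OF h(1)])
    define P where "P W \<longleftrightarrow> lie_ideal UNIV W \<and> W \<subset> ?U" for W
    have "lie_ideal UNIV {0}" by (simp add: lie_ideal_UNIV_iff)
    then have "P {0}"
      using H iU subspace_0 unfolding P_def by (fastforce simp: lie_ideal_UNIV_iff)
    \<comment> \<open>Maximal dimension among the ideals properly inside the term; this makes
      \<open>W\<close> maximal for inclusion.\<close>
    then obtain W where W: "P W" and mx: "\<And>I. P I \<Longrightarrow> dim I \<le> dim W"
      using ex_has_greatest_nat[of P "{0}" dim "Suc dimension"] dim_subset_UNIV by (metis le_imp_less_Suc)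
    have "chief_factor ?U W"
      unfolding chief_factor_def
    proof (intro conjI allI impI)
      fix I assume I: "lie_ideal UNIV I \<and> W \<subseteq> I \<and> I \<subseteq> ?U"
      show "I = W \<or> I = ?U"
      proof (rule ccontr)
        assume "\<not> ?thesis"
        with I have "P I" "I \<noteq> W" by (auto simp: P_def)
        with mx[of I] I W subspace_dim_equal[of W I] show False
          by (auto simp: P_def lie_ideal_UNIV_iff)
      qed
    qed (use iU W in \<open>auto simp: P_def\<close>)
    then have "br_span h ?U \<subseteq> W"
      using W chief_factor_solvable_trivial[OF _ h]
      by (subst br_span_subset_iff) (auto simp: P_def lie_ideal_UNIV_iff)
    then show ?thesis using W by (auto simp: P_def)
  qed
  moreover have "subspace (lower_central h n)" for n
    using lie_ideal_lower_central[OF h(1)] by (simp add: lie_ideal_UNIV_iff)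
  ultimately show False using no_descending_subspace_chain[of "lower_central h"] by blast
qed

text \<open>From \<open>[[x, y], z] = [x, [y, z]] - [y, [x, z]]\<close>. It supplies the condition
  \<open>jac\<close> on the products of summands.\<close>

lemma br_span_jacobi: "br_span (br_span A A) B \<subseteq> br_span A (br_span A B)"
proof -
  have "br (br x y) z \<in> br_span A (br_span A B)" if "x \<in> A" "y \<in> A" "z \<in> B" for x y z
  proof -
    have "br (br x y) z = br x (br y z) - br y (br x z)"
      by (simp add: br_leibniz[of x])
    then show ?thesis using that by (auto intro!: subspace_diff br_in_br_span)
  qed
  then have "br_span A A \<subseteq> {y. br y z \<in> br_span A (br_span A B)}" if "z \<in> B" for z
    using that by (subst br_span_subset_iff) (auto intro: subspace_vimage_br_left)
  then show ?thesis by (subst br_span_subset_iff) auto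
qed

section \<open>Derivations from weights\<close>

text \<open>The operator multiplying each \<open>V i\<close> by \<open>w i\<close> satisfies the
  Leibniz rule on homogeneous elements exactly because weights add along nonzero products;
  bilinearity does the rest.\<close>

lemma graded_derivation:
  assumes ds: "direct_sum I V UNIV"
    and gr: "\<And>i j. i \<in> I \<Longrightarrow> j \<in> I \<Longrightarrow> (\<forall>a\<in>V i. \<forall>b\<in>V j. br a b = 0) \<or>
               (\<exists>p\<in>I. (\<forall>a\<in>V i. \<forall>b\<in>V j. br a b \<in> V p) \<and> w i + w j = w p)"
  shows "\<exists>D. derivation D \<and> (\<forall>i\<in>I. \<forall>v\<in>V i. D v = scale (w i) v)"
proof -
  have fin: "finite I" and sV: "\<And>i. i \<in> I \<Longrightarrow> subspace (V i)"
    and dec: "\<forall>x. \<exists>v. (\<forall>i\<in>I. v i \<in> V i) \<and> x = (\<Sum>i\<in>I. v i)"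
    and ind: "\<And>v. \<forall>i\<in>I. v i \<in> V i \<Longrightarrow> (\<Sum>i\<in>I. v i) = 0 \<Longrightarrow> \<forall>i\<in>I. v i = 0"
    using ds unfolding direct_sum_def by blast+
  \<comment> \<open>Components are picked by choice; \<open>D_sum\<close> shows, through uniqueness
    of decompositions, that \<open>D\<close> may be computed from any decomposition.\<close>
  obtain c where c: "\<And>x i. i \<in> I \<Longrightarrow> c x i \<in> V i" "\<And>x. x = (\<Sum>i\<in>I. c x i)"
    using dec by metis
  define D where "D x = (\<Sum>i\<in>I. scale (w i) (c x i))" for x
  have D_sum: "D (\<Sum>i\<in>I. v i) = (\<Sum>i\<in>I. scale (w i) (v i))" if v: "\<And>i. i \<in> I \<Longrightarrow> v i \<in> V i" for v
  proof -
    let ?x = "\<Sum>i\<in>I. v i"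
    have "(\<Sum>i\<in>I. c ?x i - v i) = 0"
      using c(2)[of ?x] by (simp add: sum_subtractf)
    then have "\<forall>i\<in>I. c ?x i - v i = 0"
      by (rule ind[rotated]) (use c v in \<open>auto intro: subspace_diff sV\<close>)
    then show ?thesis unfolding D_def by (intro sum.cong) auto
  qed
  have D_hom: "D v = scale (w i) v" if "i \<in> I" "v \<in> V i" for i v
    using D_sum[of "\<lambda>j. if j = i then v else 0"] that fin sV
    by (simp add: subspace_0 sum.delta if_distrib[of "scale _"] cong: if_cong)
  have "D (x + y) = D x + D y" for x y
  proof -
    have "x + y = (\<Sum>i\<in>I. c x i + c y i)"
      using c(2)[of x] c(2)[of y] by (simp add: sum.distrib)
    then show ?thesis
      using D_sum[of "\<lambda>i. c x i + c y i"] c(1) sV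
      by (simp add: subspace_add scale_right_distrib sum.distrib) (simp add: D_def)
  qed
  moreover have "D (scale a x) = scale a (D x)" for a x
  proof -
    have "scale a x = (\<Sum>i\<in>I. scale a (c x i))"
      using c(2)[of x] by (simp flip: scale_sum_right)
    then show ?thesis
      using D_sum[of "\<lambda>i. scale a (c x i)"] c(1) sV
      by (simp add: subspace_scale D_def scale_sum_right mult.commute)
  qed
  ultimately have lin: "Vector_Spaces.linear scale scale D"
    by unfold_locales auto
  interpret D: Vector_Spaces.linear scale scale D by (rule lin)
  have D_br: "D (br a b) = scale (w i + w j) (br a b)" if "i \<in> I" "j \<in> I" "a \<in> V i" "b \<in> V j" for i j a b
    using gr[OF that(1,2)]
  proof
    assume "\<forall>a\<in>V i. \<forall>b\<in>V j. br a b = 0"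
    then show ?thesis using that by (simp add: D.zero)
  next
    assume "\<exists>p\<in>I. (\<forall>a\<in>V i. \<forall>b\<in>V j. br a b \<in> V p) \<and> w i + w j = w p"
    then show ?thesis using that D_hom by auto
  qed
  have "D (br x y) = br (D x) y + br x (D y)" for x y
  proof -
    have x: "br x z = (\<Sum>i\<in>I. br (c x i) z)" for z
      by (subst c(2)[of x]) (rule br_sum_left)
    have y: "br z y = (\<Sum>j\<in>I. br z (c y j))" for z
      by (subst c(2)[of y]) (rule br_sum_right)
    have "br x y = (\<Sum>i\<in>I. \<Sum>j\<in>I. br (c x i) (c y j))"
      by (simp only: x) (simp only: y)
    then have "D (br x y) = (\<Sum>i\<in>I. \<Sum>j\<in>I. scale (w i + w j) (br (c x i) (c y j)))"
      by (simp add: D.sum D_br c(1))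
    moreover have "br (D x) y = (\<Sum>i\<in>I. \<Sum>j\<in>I. scale (w i) (br (c x i) (c y j)))"
      by (simp only: D_def br_sum_left br_scale_left) (simp only: y scale_sum_right)
    moreover have "br x (D y) = (\<Sum>i\<in>I. \<Sum>j\<in>I. scale (w j) (br (c x i) (c y j)))"
      by (simp only: x) (simp only: D_def br_sum_right br_scale_right)
    ultimately show ?thesis by (simp add: scale_left_distrib sum.distrib)
  qed
  then have "derivation D" using lin by (simp add: derivation_def)
  then show ?thesis using D_hom by blast
qed

section \<open>Levi factor and radical\<close>

text \<open>Every bracket is one of two elements of \<open>L\<close> plus an element of
  \<open>[g, h]\<close>, so a perfect \<open>g\<close> equals \<open>L + [g, h]\<close>. For an
  element of \<open>h\<close> the part in \<open>L\<close> lies in \<open>L \<inter> h\<close>,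
  hence vanishes.\<close>

lemma radical_subset_br_span:
  assumes "levi_decomposition L h" and "br_span UNIV UNIV = UNIV"
  shows "h \<subseteq> br_span UNIV h"
proof
  have L: "lie_subalgebra L" and ih: "lie_ideal UNIV h" and Lh: "L \<inter> h = {0}"
    and dec: "\<And>x. \<exists>l\<in>L. \<exists>r\<in>h. x = l + r"
    using assms(1) by (auto simp: levi_decomposition_def is_radical_def)
  let ?M = "{x + y |x y. x \<in> L \<and> y \<in> br_span UNIV h}"
  have "br x y \<in> ?M" for x y
  proof -
    obtain l r l' r' where x: "l \<in> L" "r \<in> h" "x = l + r" and y: "l' \<in> L" "r' \<in> h" "y = l' + r'"
      using dec by meson
    have "br x y = br l l' + (br l r' - br y r)"
      using x y br_swap[of r y] by (simp add: br_add_left br_add_right)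
    moreover have "br l l' \<in> L" using L x y by (simp add: lie_subalgebra_def)
    moreover have "br l r' - br y r \<in> br_span UNIV h"
      using x y by (intro subspace_diff br_in_br_span) auto
    ultimately show ?thesis by blast
  qed
  then have "br_span UNIV UNIV \<subseteq> ?M"
    using L by (subst br_span_subset_iff) (auto simp: lie_subalgebra_def intro!: subspace_sums)
  then have all: "x \<in> ?M" for x using assms(2) by blast
  fix v assume v: "v \<in> h"
  obtain l u where lu: "v = l + u" "l \<in> L" "u \<in> br_span UNIV h" using all[of v] by blast
  have "u \<in> h"
    using lu(3) ih br_span_subset_iff[of h UNIV h] by (auto simp: lie_ideal_UNIV_iff)
  then have "v - u \<in> h" using v ih by (auto simp: lie_ideal_UNIV_iff intro: subspace_diff)
  then have "l = 0" using lu Lh by auto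
  then show "v \<in> br_span UNIV h" using lu by simp
qed

text \<open>For \<open>x = l + r\<close> centralizing \<open>L\<close>, the bracket
  \<open>[l, y] = [y, r]\<close> lies in \<open>L \<inter> h\<close> and vanishes. So
  \<open>l\<close> is in the center of \<open>L\<close>, which is zero as \<open>L\<close> is simple
  and nonabelian.\<close>

lemma centralizer_levi_subset_radical:
  assumes levi: "levi_decomposition L h" and simple: "simple_lie L"
    and x: "\<And>y. y \<in> L \<Longrightarrow> br x y = 0"
  shows "x \<in> h"
proof -
  have L: "lie_subalgebra L" and ih: "lie_ideal UNIV h" and Lh: "L \<inter> h = {0}"
    and dec: "\<And>x. \<exists>l\<in>L. \<exists>r\<in>h. x = l + r"
    using levi by (auto simp: levi_decomposition_def is_radical_def)
  obtain l r where lr: "l \<in> L" "r \<in> h" "x = l + r" using dec by blast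
  let ?C = "{z\<in>L. \<forall>y\<in>L. br z y = 0}"
  have "br l y = 0" if y: "y \<in> L" for y
  proof -
    have "br l y = br y r"
      using x[OF y] lr br_swap[of r y] by (simp add: br_add_left)
    then have "br l y \<in> h" using ih lr by (simp add: lie_ideal_UNIV_iff)
    moreover have "br l y \<in> L" using L lr y by (simp add: lie_subalgebra_def)
    ultimately show ?thesis using Lh by blast
  qed
  then have l: "l \<in> ?C" using lr by blast
  have "br y z = 0" if "z \<in> ?C" "y \<in> L" for y z
    using that br_swap[of y z] by simp
  then have "lie_ideal L ?C"
    using L by (auto simp: lie_ideal_def lie_subalgebra_def subspace_def br_add_left br_scale_left)
  then have "?C = {0} \<or> ?C = L" using simple by (simp add: simple_lie_def)
  moreover have "?C \<noteq> L"
  proof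
    assume "?C = L"
    then have "\<forall>a\<in>L. \<forall>b\<in>L. br a b = 0" by blast
    then have "br_span L L \<subseteq> {0}" by (subst br_span_subset_iff) auto
    then show False using simple subspace_0[of "br_span L L"] by (auto simp: simple_lie_def)
  qed
  ultimately have "l = 0" using l by blast
  then show ?thesis using lr by simp
qed

text \<open>Treats the Levi factor as one more summand, with the fresh index \<open>a\<close>, so
  that a graded derivation can be built on the whole algebra.\<close>

lemma direct_sum_insert:
  assumes V: "direct_sum I V h" and a: "a \<notin> I" and sL: "subspace L"
    and Lh: "L \<inter> h = {0}" and dec: "\<And>x. \<exists>l\<in>L. \<exists>r\<in>h. x = l + r"
  shows "direct_sum (insert a I) (V(a := L)) UNIV"
proof -
  have fin: "finite I" and sV: "\<And>i. i \<in> I \<Longrightarrow> subspace (V i)"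
    and h: "h = {\<Sum>i\<in>I. v i | v. \<forall>i\<in>I. v i \<in> V i}"
    and ind: "\<And>v. \<forall>i\<in>I. v i \<in> V i \<Longrightarrow> (\<Sum>i\<in>I. v i) = 0 \<Longrightarrow> \<forall>i\<in>I. v i = 0"
    using V unfolding direct_sum_def by blast+
  have upd: "(V(a := L)) i = V i" if "i \<in> I" for i using that a by auto
  have sum_upd: "(\<Sum>i\<in>insert a I. v i) = v a + (\<Sum>i\<in>I. v i)" for v :: "_ \<Rightarrow> 'g"
    using fin a by simp
  have "\<exists>v. x = (\<Sum>i\<in>insert a I. v i) \<and> (\<forall>i\<in>insert a I. v i \<in> (V(a := L)) i)" for x
  proof -
    obtain l v where lv: "l \<in> L" "x = l + (\<Sum>i\<in>I. v i)" "\<forall>i\<in>I. v i \<in> V i"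
      using dec[of x] unfolding h by blast
    have "(\<Sum>i\<in>I. (v(a := l)) i) = (\<Sum>i\<in>I. v i)"
      using a by (intro sum.cong) auto
    then show ?thesis
      using lv upd a by (intro exI[of _ "v(a := l)"]) (auto simp: sum_upd)
  qed
  moreover have "\<forall>i\<in>insert a I. v i = 0"
    if v: "\<forall>i\<in>insert a I. v i \<in> (V(a := L)) i" and s: "(\<Sum>i\<in>insert a I. v i) = 0" for v
  proof -
    have vV: "\<forall>i\<in>I. v i \<in> V i" and va: "v a \<in> L" using v upd by auto
    have "(\<Sum>i\<in>I. v i) \<in> h" using vV unfolding h by blast
    moreover have e: "v a = - (\<Sum>i\<in>I. v i)" using s by (simp add: sum_upd eq_neg_iff_add_eq_0)
    then have "(\<Sum>i\<in>I. v i) = - v a" by simp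
    then have "(\<Sum>i\<in>I. v i) \<in> L" using va sL by (simp add: subspace_neg)
    ultimately have "(\<Sum>i\<in>I. v i) = 0" using Lh by blast
    then show ?thesis using ind[OF vV] e by auto
  qed
  ultimately show ?thesis
    using fin sV upd sL unfolding direct_sum_def by auto
qed

text \<open>With \<open>c\<close> nonzero, \<open>v = [x, v] / c\<close> would climb through all
  terms of the lower central series.\<close>

lemma br_eigenvalue_zero:
  assumes h: "lower_central h N = {0}" and x: "x \<in> h" and v: "v \<in> h" "br x v = scale c v" "v \<noteq> 0"
  shows "c = 0"
proof (rule ccontr)
  assume c: "c \<noteq> 0"
  have "v \<in> lower_central h n" for n
  proof (induction n)
    case (Suc n)
    have "scale c v \<in> lower_central h (Suc n)"
      using br_in_br_span[OF x Suc] v(2) by simp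
    moreover have "subspace (lower_central h (Suc n))" by simp
    ultimately have "scale (inverse c) (scale c v) \<in> lower_central h (Suc n)"
      by (rule subspace_scale[rotated])
    then show ?case using c by simp
  qed (use v in simp)
  then show False using h v(3) by blast
qed

section \<open>Excluding three or fewer summands\<close>

lemma sympathetic_at_least_four_summands:
  fixes V :: "'i \<Rightarrow> 'g set"
  assumes nss: "\<not> semisimple UNIV" and levi: "levi_decomposition L h" and simple: "simple_lie L"
    and V: "direct_sum I V h" and smod: "\<And>i. i \<in> I \<Longrightarrow> simple_module L (V i)"
    and prod: "\<And>i j. i \<in> I \<Longrightarrow> j \<in> I \<Longrightarrow> br_span (V i) (V j) \<noteq> {0} \<Longrightarrow>
                 \<exists>!p. p \<in> I \<and> br_span (V i) (V j) = V p"
    and symp: "sympathetic" and a: "a \<notin> I"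
  shows "card I \<ge> 4"
proof (rule ccontr)
  assume "\<not> card I \<ge> 4"
  then have card: "card I \<le> 3" by simp
  have ih: "lie_ideal UNIV h" and sol: "solvable h" and L: "lie_subalgebra L" and Lh: "L \<inter> h = {0}"
    and dec: "\<And>x. \<exists>l\<in>L. \<exists>r\<in>h. x = l + r" and rad: "is_radical UNIV h"
    using levi by (auto simp: levi_decomposition_def is_radical_def)
  have fin: "finite I" and hV: "h = {\<Sum>i\<in>I. v i | v. \<forall>i\<in>I. v i \<in> V i}"
    using V unfolding direct_sum_def by blast+
  have sV: "subspace (V i)" and V0: "V i \<noteq> {0}" and LV: "\<And>l v. l \<in> L \<Longrightarrow> v \<in> V i \<Longrightarrow> br l v \<in> V i"
    if "i \<in> I" for i
    using smod[OF that] by (auto simp: simple_module_def lie_module_def)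
  have Vh: "V i \<subseteq> h" if i: "i \<in> I" for i
  proof
    fix v assume v: "v \<in> V i"
    have "(\<Sum>j\<in>I. if j = i then v else 0) = v" using fin i by simp
    moreover have "\<forall>j\<in>I. (if j = i then v else 0) \<in> V j" using v sV by (simp add: subspace_0)
    ultimately show "v \<in> h" unfolding hV by force
  qed
  have ne: "I \<noteq> {}"
  proof
    assume "I = {}"
    then have "h = {0}" unfolding hV by auto
    then show False using rad nss by (simp add: semisimple_def)
  qed
  obtain N where N: "lower_central h N = {0}"
    using lower_central_vanishes[OF ih sol radical_subset_br_span[OF levi]] symp
    by (auto simp: sympathetic_def)
  define m where "m i j p \<longleftrightarrow> i \<in> I \<and> j \<in> I \<and> p \<in> I \<and> br_span (V i) (V j) = V p" for i j p
  \<comment> \<open>The first term not containing \<open>V i\<close>. It is positive since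
    \<open>V i \<subseteq> h\<close>, so \<open>V i\<close> lies in term \<open>r i - 1\<close>, and
    a product with it lies in term \<open>r i\<close>.\<close>
  define r where "r i = (LEAST n. \<not> V i \<subseteq> lower_central h n)" for i
  have r: "\<not> V i \<subseteq> lower_central h (r i)" "\<And>n. n < r i \<Longrightarrow> V i \<subseteq> lower_central h n" if i: "i \<in> I" for i
  proof -
    have "\<not> V i \<subseteq> lower_central h N" using N V0[OF i] sV[OF i] subspace_0 by fastforce
    then show "\<not> V i \<subseteq> lower_central h (r i)" unfolding r_def by (rule LeastI)
    show "\<And>n. n < r i \<Longrightarrow> V i \<subseteq> lower_central h n" unfolding r_def using not_less_Least by blast
  qed
  have sym: "m j i p" if "m i j p" for i j p
    using that br_span_commute by (auto simp: m_def)
  have rank: "r i < r p" if "m i j p" for i j p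
  proof -
    have I: "i \<in> I" "j \<in> I" "p \<in> I" and p: "V p = br_span (V j) (V i)"
      using sym[OF that] by (auto simp: m_def)
    have "r i \<noteq> 0" using r(1)[OF I(1)] Vh[OF I(1)] by (metis lower_central.simps(1))
    then obtain n where n: "r i = Suc n" by (cases "r i") auto
    have "V p \<subseteq> lower_central h (r i)"
      unfolding p n using r(2)[OF I(1), of n] n Vh[OF I(2)]
      by (subst br_span_subset_iff) (auto intro: br_in_br_span)
    moreover have "lower_central h (r i) \<subseteq> lower_central h (r p)" if "r p \<le> r i"
      using lower_central_antimono[OF ih that] .
    ultimately show ?thesis using r(1)[OF I(3)] by (meson not_le subset_trans)
  qed
  have ex: "\<exists>p. m i j p" if "i \<in> I" "j \<in> I" "br_span (V i) (V j) \<noteq> {0}" for i j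
    using prod[OF that] that by (auto simp: m_def)
  have zero: "br_span A {0} = {0}" for A
    using br_span_subset_iff[of "{0}" A "{0}"] subspace_0[of "br_span A {0}"] by auto
  have "\<exists>w. (\<exists>i\<in>I. w i \<noteq> (0 :: complex)) \<and> (\<forall>i j p. m i j p \<longrightarrow> w i + w j = w p)"
  proof (rule additive_weights_exist[of I m r])
    show "finite I" "card I \<le> 3" "I \<noteq> {}" by (fact fin card ne)+
    show "i \<in> I \<and> j \<in> I \<and> p \<in> I" if "m i j p" for i j p using that by (simp add: m_def)
    show "m j i p" if "m i j p" for i j p using that by (rule sym)
    show "r i < r p" if "m i j p" for i j p using that by (rule rank)
    show "p = q" if "m i j p" "m i j q" for i j p q
      using that prod[of i j] V0 by (auto simp: m_def)
    show "\<exists>d e. m a b d \<and> m a d e" if ab: "m a a b" and bc: "m b b c" for a b c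
    proof -
      have I: "a \<in> I" "b \<in> I" "c \<in> I" using ab bc by (auto simp: m_def)
      \<comment> \<open>Here \<open>V c = [V b, V b]\<close> is rewritten as
        \<open>[[V a, V a], V b]\<close>.\<close>
      have "V c \<subseteq> br_span (V a) (br_span (V a) (V b))"
        using br_span_jacobi[of "V a" "V b"] ab bc by (simp add: m_def)
      then have nz: "br_span (V a) (br_span (V a) (V b)) \<noteq> {0}"
        using V0[OF I(3)] subspace_0[OF sV[OF I(3)]] by blast
      then have "br_span (V a) (V b) \<noteq> {0}" using zero by auto
      then obtain d where d: "m a b d" using ex I by blast
      then have "br_span (V a) (V d) \<noteq> {0}" "d \<in> I" using nz by (auto simp: m_def)
      then show ?thesis using ex I d by blast
    qed
  qed
  then obtain w :: "'i \<Rightarrow> complex" and i0 where i0: "i0 \<in> I" "w i0 \<noteq> 0" and w: "\<And>i j p. m i j p \<Longrightarrow> w i + w j = w p"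
    by blast
  \<comment> \<open>The Levi factor gets weight 0, which fits \<open>[L, L] \<subseteq> L\<close>
    and \<open>[L, V i] \<subseteq> V i\<close>.\<close>
  have upd: "(V(a := L)) i = V i" "(w(a := 0)) i = w i" if "i \<in> I" for i using that a by auto
  have VL: "(V(a := L)) a = L" "(w(a := 0)) a = 0" by simp_all
  have "\<exists>D. derivation D \<and> (\<forall>i\<in>insert a I. \<forall>v\<in>(V(a := L)) i. D v = scale ((w(a := 0)) i) v)"
  proof (rule graded_derivation)
    show "direct_sum (insert a I) (V(a := L)) UNIV"
      using L by (intro direct_sum_insert[OF V a _ Lh dec]) (simp add: lie_subalgebra_def)
    fix i j assume ij: "i \<in> insert a I" "j \<in> insert a I"
    let ?Q = "\<lambda>i j. (\<forall>x\<in>(V(a := L)) i. \<forall>b\<in>(V(a := L)) j. br x b = 0) \<or>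
               (\<exists>p\<in>insert a I. (\<forall>x\<in>(V(a := L)) i. \<forall>b\<in>(V(a := L)) j. br x b \<in> (V(a := L)) p) \<and>
                 (w(a := 0)) i + (w(a := 0)) j = (w(a := 0)) p)"
    consider "i = a" "j = a" | "i = a" "j \<in> I" | "i \<in> I" "j = a" | "i \<in> I" "j \<in> I"
      using ij by blast
    then show "?Q i j"
    proof cases
      case 1
      then show ?thesis using L by (auto simp: lie_subalgebra_def)
    next
      case 2
      then show ?thesis using LV upd VL by (intro disjI2 bexI[of _ j]) auto
    next
      case 3
      have "br v l \<in> V i" if "l \<in> L" "v \<in> V i" for l v
        using LV[OF 3(1) that] subspace_neg[OF sV[OF 3(1)]] br_swap[of v l] by simp
      then show ?thesis using 3 upd VL by (intro disjI2 bexI[of _ i]) auto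
    next
      case 4
      show ?thesis
      proof (cases "br_span (V i) (V j) = {0}")
        case True
        then have "\<forall>x\<in>V i. \<forall>b\<in>V j. br x b = 0" using br_in_br_span by blast
        then show ?thesis using upd 4 by simp
      next
        case False
        then obtain p where p: "m i j p" using ex 4 by blast
        then have "\<forall>x\<in>V i. \<forall>b\<in>V j. br x b \<in> V p" "p \<in> I"
          using br_in_br_span unfolding m_def by blast+
        then show ?thesis using upd 4 w[OF p] by (intro disjI2 bexI[of _ p]) auto
      qed
    qed
  qed
  then obtain D where "derivation D"
      and *: "\<And>i v. i \<in> insert a I \<Longrightarrow> v \<in> (V(a := L)) i \<Longrightarrow> D v = scale ((w(a := 0)) i) v"
    by blast
  then have D: "derivation D" "\<And>l. l \<in> L \<Longrightarrow> D l = 0"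
    using *[of a] by auto
  have D_hom: "D v = scale (w i) v" if "i \<in> I" "v \<in> V i" for i v
    using *[of i v] upd that by simp
  \<comment> \<open>All derivations are inner; since \<open>D\<close> vanishes on \<open>L\<close>,
    the element \<open>x\<close> centralizes \<open>L\<close>.\<close>
  obtain x where x: "D = br x"
    using D(1) symp unfolding sympathetic_def by blast
  have xh: "x \<in> h"
    by (rule centralizer_levi_subset_radical[OF levi simple]) (use D(2) x in simp)
  obtain v where v: "v \<in> V i0" "v \<noteq> 0"
    using V0[OF i0(1)] subspace_0[OF sV[OF i0(1)]] by blast
  \<comment> \<open>A nonzero vector of \<open>V i0\<close> is an eigenvector of \<open>ad x\<close>
    with eigenvalue \<open>w i0\<close>, while \<open>x\<close> lies in the nilpotent ideal
    \<open>h\<close>.\<close>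
  have "w i0 = 0"
    by (rule br_eigenvalue_zero[OF N xh _ _ v(2)]) (use v Vh D_hom x i0 in auto)
  then show False using i0 by simp
qed

end

theorem theorem3p13:
  fixes scale :: "complex \<Rightarrow> 'g::ab_group_add \<Rightarrow> 'g"
    and br :: "'g \<Rightarrow> 'g \<Rightarrow> 'g"
    and L h :: "'g set"
    and k :: nat
    and V :: "nat \<Rightarrow> 'g set"
  assumes "fd_lie_algebra scale br"
    and "\<not> fd_lie_algebra.semisimple scale br UNIV"
    and "fd_lie_algebra.levi_decomposition scale br L h"
    and "fd_lie_algebra.simple_lie scale br L"
    and "fd_lie_algebra.direct_sum scale {1..k} V h"
    and "\<And>i. i \<in> {1..k} \<Longrightarrow> fd_lie_algebra.simple_module scale br L (V i)"
    and "\<And>i j. i \<in> {1..k} \<Longrightarrow> j \<in> {1..k} \<Longrightarrow>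
           fd_lie_algebra.br_span scale br (V i) (V j) \<noteq> {0} \<Longrightarrow>
           \<exists>!p. p \<in> {1..k} \<and> fd_lie_algebra.br_span scale br (V i) (V j) = V p"
    and "fd_lie_algebra.sympathetic scale br"
  shows "k \<ge> 4"
proof -
  interpret fd_lie_algebra scale br by (rule assms(1))
  have "card {1..k} \<ge> 4"
    \<comment> \<open>The index 0 lies outside \<open>{1..k}\<close> and is free to label the Levi
      factor.\<close>
    by (rule sympathetic_at_least_four_summands[OF assms(2-8), of 0]) auto
  then show ?thesis by simp
qed

end
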